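(* An episturmian word $\mathbf t$ over a finite alphabet $\mathcal A$ is quasiperiodic if and only if the normalized directive word of $\mathbf t$ takes the form \[ \breve w\, a\, v_1\, \bar a\, v_2\, \bar a \cdots v_k\, \bar a\, v\, \breve{\mathbf y} \] for some letter $a\in\mathcal A$ (spin $L$), spinned finite word $\breve w$, $a$-free words $v, v_1,\dots,v_k\in\mathcal A^*$ (spin $L$, $k\ge0$), and a spinned version $\breve{\mathbf y}$ of an infinite word $\mathbf y\in\mathcal A^\omega$ such that $\mathrm{Alph}(av)=\mathrm{Alph}(av\mathbf y)$.
   Context: $\mathrm{Alph}(u)$ is the set of letters of $u$. For $a\in\mathcal{A}$, $L_a,R_a$ are the morphisms with $L_a(a)=R_a(a)=a$, $L_a(b)=ab$, $R_a(b)=ba$ ($b\ne a$). Spinned words are words over $\mathcal A\cup\bar{\mathcal A}$, $\bar{\mathcal A}=\{\bar x:x\in\mathcal A\}$ (letters of $\mathcal A$ have spin $L$, of $\bar{\mathcal A}$ spin $R$); a spinned version of a word over $\mathcal A$ is obtained by possibly barring some of its letters; for $u\in\mathcal A^*$, $\bar u$ is $u$ with all letters barred. $\mu_a=L_a$, $\mu_{\bar a}=R_a$, $\mu_{\breve x_1\cdots\breve x_n}=\mu_{\breve x_1}\circ\cdots\circ\mu_{\breve x_n}$. An infinite word is episturmian if its set of factors is closed under reversal and it has at most one right special factor of each length. A spinned infinite word $\breve x_1\breve x_2\cdots$ directs $\mathbf t$ if there are recurrent infinite words $\mathbf t^{(n)}$ with $\mathbf t^{(0)}=\mathbf t$ and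 $\mathbf t^{(n-1)}=\mu_{\breve x_n}(\mathbf t^{(n)})$ for $n\ge1$. A normalized directive word of $\mathbf t$ is a directive word of $\mathbf t$ containing infinitely many $L$-spinned letters and no factor in $\bigcup_{a\in\mathcal A}\bar a\bar{\mathcal A}^*a$; every episturmian word has one, and it is unique when $\mathbf t$ is aperiodic. A finite word $u$ is a quasiperiod of an infinite word $\mathbf w$ if there are words $p_n$ ($n\ge0$) with $p_0=\varepsilon$, $|p_n|<|p_{n+1}|\le|p_nu|$, $p_nu$ a prefix of $\mathbf w$; $\mathbf w$ is quasiperiodic if it has a quasiperiod. *)

theory Defs
  imports "HOL-Library.Stream"
begin

text \<open>Finite words are lists, infinite words are streams; the alphabet is the universe of the
  letter type.\<close>

definition prefix_of :: "'a list \<Rightarrow> 'a stream \<Rightarrow> bool" where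
  "prefix_of u w \<longleftrightarrow> (\<exists>z. w = u @- z)"

definition factor_of :: "'a list \<Rightarrow> 'a stream \<Rightarrow> bool" where
  "factor_of u w \<longleftrightarrow> (\<exists>p z. w = p @- u @- z)"

definition recurrent :: "'a stream \<Rightarrow> bool" where
  "recurrent w \<longleftrightarrow> (\<forall>u. factor_of u w \<longrightarrow> infinite {i. prefix_of u (sdrop i w)})"

definition right_special :: "'a list \<Rightarrow> 'a stream \<Rightarrow> bool" where
  "right_special u w \<longleftrightarrow> (\<exists>a b. a \<noteq> b \<and> factor_of (u @ [a]) w \<and> factor_of (u @ [b]) w)"

definition episturmian :: "'a stream \<Rightarrow> bool" where
  "episturmian w \<longleftrightarrow>
     (\<forall>u. factor_of u w \<longrightarrow> factor_of (rev u) w) \<and>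
     (\<forall>u v. right_special u w \<and> right_special v w \<and> length u = length v \<longrightarrow> u = v)"

definition quasiperiod :: "'a list \<Rightarrow> 'a stream \<Rightarrow> bool" where
  "quasiperiod u w \<longleftrightarrow>
     (\<exists>p :: nat \<Rightarrow> 'a list. p 0 = [] \<and>
        (\<forall>n. length (p n) < length (p (Suc n)) \<and>
             length (p (Suc n)) \<le> length (p n @ u) \<and>
             prefix_of (p n @ u) w))"

definition quasiperiodic :: "'a stream \<Rightarrow> bool" where
  "quasiperiodic w \<longleftrightarrow> (\<exists>u. quasiperiod u w)"

text \<open>\<open>SpinL a\<close> is the letter \<open>a\<close> itself, \<open>SpinR a\<close> is its barred copy.\<close>

datatype 'a spinned = is_SpinL: SpinL (letter: 'a) | SpinR (letter: 'a)

definition spinned_version :: "'a spinned stream \<Rightarrow> 'a stream \<Rightarrow> bool" where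
  "spinned_version sy y \<longleftrightarrow> smap letter sy = y"

definition morphL :: "'a \<Rightarrow> 'a \<Rightarrow> 'a list" where
  "morphL a b = (if b = a then [a] else [a, b])"

definition morphR :: "'a \<Rightarrow> 'a \<Rightarrow> 'a list" where
  "morphR a b = (if b = a then [a] else [b, a])"

fun mu :: "'a spinned \<Rightarrow> 'a \<Rightarrow> 'a list" where
  "mu (SpinL a) = morphL a"
| "mu (SpinR a) = morphR a"

text \<open>The action on infinite words. The images of letters under \<open>mu x\<close> are nonempty, so \<open>flat\<close>
  is their infinite concatenation.\<close>

definition mu_inf :: "'a spinned \<Rightarrow> 'a stream \<Rightarrow> 'a stream" where
  "mu_inf x w = flat (smap (mu x) w)"

text \<open>Streams are indexed from 0, so \<open>d !! n\<close> is the (n+1)-st letter of the directive word.\<close>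

definition directs :: "'a spinned stream \<Rightarrow> 'a stream \<Rightarrow> bool" where
  "directs d t \<longleftrightarrow>
     (\<exists>ts :: nat \<Rightarrow> 'a stream. ts 0 = t \<and> (\<forall>n. recurrent (ts n)) \<and>
        (\<forall>n. ts n = mu_inf (d !! n) (ts (Suc n))))"

definition normalized_directive_word :: "'a spinned stream \<Rightarrow> 'a stream \<Rightarrow> bool" where
  "normalized_directive_word d t \<longleftrightarrow>
     directs d t \<and>
     infinite {n. is_SpinL (d !! n)} \<and>
     (\<forall>a u. \<not> factor_of ([SpinR a] @ map SpinR u @ [SpinL a]) d)"

end

theory Submission
  imports Defs
begin

text \<open>
  Every word \<open>h(s)\<close>, with \<open>h\<close> a composition of morphisms \<open>L\<^sub>b\<close>, \<open>R\<^sub>b\<close>, starts with a word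
  \<open>lead h\<close> independent of \<open>s\<close>. If \<open>|h(x)| \<le> |lead h|\<close> for all letters \<open>x\<close> of \<open>s\<close>, the blocks
  \<open>h(x)\<close> of \<open>h(s)\<close> are short enough for the copies of \<open>lead h\<close> at their left ends to cover
  \<open>h(s)\<close>. Conversely, a quasiperiod of \<open>t\<close> can be desubstituted along a normalized directive word:
  normalization guarantees that a word to which \<open>R\<^sub>b\<close> is applied does not start with \<open>b\<close>, so
  occurrences stay synchronized. Each step with spin \<open>L\<close> shortens the desubstituted quasiperiod;
  when it becomes empty, the covering condition reads \<open>|h(x)| \<le> |lead h|\<close> for all letters
  \<open>x\<close> of the current word.

  Since \<open>|h(a)| + |h(b)| > |lead h|\<close> for \<open>a \<noteq> b\<close>, the inequality \<open>|h(x)| \<le> |lead h|\<close> holds exactly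
  when \<open>h\<close> contains an \<open>x\<close> of spin \<open>L\<close> after which no letter other than \<open>x\<close> has spin \<open>R\<close>.
  Taking for \<open>a\<close> the letter of the remaining directive word whose last such occurrence is
  leftmost gives the required factorization.
\<close>

section \<open>Morphisms acting on finite and infinite words\<close>

lemma prefix_of_Nil [simp]: "prefix_of [] s"
  by (simp add: prefix_of_def)

lemma prefix_of_Cons: "prefix_of (x # u) s \<longleftrightarrow> shd s = x \<and> prefix_of u (stl s)"
  unfolding prefix_of_def by (metis shift.simps stream.collapse stream.sel)

definition morph :: "'a spinned \<Rightarrow> 'a list \<Rightarrow> 'a list" where
  "morph x u = concat (map (mu x) u)"

definition morphs :: "'a spinned list \<Rightarrow> 'a list \<Rightarrow> 'a list" where
  "morphs h = foldr morph h"

lemma morph_simps [simp]: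
  "morph x [] = []" "morph x (c # u) = mu x c @ morph x u" "morph x (u @ v) = morph x u @ morph x v"
  by (simp_all add: morph_def)

lemma morphs_simps [simp]:
  "morphs [] u = u" "morphs (x # h) u = morph x (morphs h u)"
  "morphs (h @ h') u = morphs h (morphs h' u)"
  by (simp_all add: morphs_def)

lemma morphs_append [simp]: "morphs h (u @ v) = morphs h u @ morphs h v"
  by (induction h) simp_all

lemma morphs_Nil [simp]: "morphs h [] = []"
  by (induction h) simp_all

lemma morphs_Cons: "morphs h (c # u) = morphs h [c] @ morphs h u"
  using morphs_append[of h "[c]" u] by simp

lemma mu_nonempty [simp]: "mu x c \<noteq> []"
  by (cases x) (auto simp: morphL_def morphR_def)

lemma morph_eq_Nil_iff [simp]: "morph x u = [] \<longleftrightarrow> u = []"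
  by (cases u) auto

lemma morphs_eq_Nil_iff [simp]: "morphs h u = [] \<longleftrightarrow> u = []"
  by (induction h) auto

lemma mu_inf_SCons [simp]: "mu_inf x (c ## s) = mu x c @- mu_inf x s"
  unfolding mu_inf_def by (subst flat_unfold) simp_all

lemma mu_inf_shift [simp]: "mu_inf x (u @- s) = morph x u @- mu_inf x s"
  by (induction u) simp_all

lemma foldr_mu_inf_shift: "foldr mu_inf h (u @- s) = morphs h u @- foldr mu_inf h s"
  by (induction h) simp_all

lemma mu_inf_SpinR_unfold:
  "mu_inf (SpinR b) s =
     (if shd s = b then b ## mu_inf (SpinR b) (stl s)
      else shd s ## b ## mu_inf (SpinR b) (stl s))"
  using mu_inf_SCons[of "SpinR b" "shd s" "stl s"] by (simp add: morphR_def)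

section \<open>Conjugacy of the two spins and cuts at block boundaries\<close>

text \<open>Letter by letter L_b(c) b = b R_b(c), so the extra b can be pushed to the right forever.
  The induction compares prefixes, a block using up one or two letters.\<close>

lemma mu_inf_SpinL_conv_SpinR: "mu_inf (SpinL b) s = b ## mu_inf (SpinR b) s"
proof -
  have "stake n (mu_inf (SpinL b) s) = stake n (b ## mu_inf (SpinR b) s)" for n
  proof (induction n arbitrary: s rule: less_induct)
    case (less n)
    obtain c s' where s: "s = c ## s'" by (cases s)
    consider "n = 0" | "n = 1" | m where "n = Suc (Suc m)"
      by (metis One_nat_def not0_implies_Suc)
    then show ?case
    proof cases
      case 3
      then show ?thesis
        using less.IH[of "Suc m" s'] less.IH[of m s'] by (auto simp: s morphL_def morphR_def)
    qed (auto simp: s morphL_def)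
  qed
  then have "mu_inf (SpinL b) s !! n = (b ## mu_inf (SpinR b) s) !! n" for n
    by (metis lessI stake_nth)
  then show ?thesis
    using smap_alt[of id] by (metis id_apply stream.map_id)
qed

text \<open>The blocks of R_b are b and cb with c other than b, so a cut inside a block is followed
  by b. A cut before any other letter is therefore a block boundary and can be pulled back.\<close>

lemma mu_inf_SpinR_split:
  assumes "mu_inf (SpinR b) s = g @- s'" and "shd s' \<noteq> b"
  shows "\<exists>g1 s1. s = g1 @- s1 \<and> g = morph (SpinR b) g1 \<and> s' = mu_inf (SpinR b) s1"
  using assms
proof (induction "length g" arbitrary: g s rule: less_induct)
  case less
  show ?case
  proof (cases g)
    case Nil
    then show ?thesis using less.prems by (intro exI[of _ "[]"] exI[of _ s]) simp
  next
    case (Cons c g')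
    obtain e r where s: "s = e ## r" by (cases s)
    have e: "e = c" using less.prems(1) by (auto simp: s Cons morphR_def split: if_splits)
    show ?thesis
    proof (cases "c = b")
      case True
      then have "mu_inf (SpinR b) r = g' @- s'"
        using less.prems(1) by (simp add: s e Cons morphR_def)
      from less.hyps[OF _ this less.prems(2)] obtain g1 s1 where
        "r = g1 @- s1" "g' = morph (SpinR b) g1" "s' = mu_inf (SpinR b) s1"
        by (auto simp: Cons)
      then show ?thesis
        using True by (intro exI[of _ "c # g1"] exI[of _ s1]) (simp add: s e Cons morphR_def)
    next
      case False
      then have *: "b ## mu_inf (SpinR b) r = g' @- s'"
        using less.prems(1) by (simp add: s e Cons morphR_def)
      then obtain g'' where g': "g' = b # g''" "mu_inf (SpinR b) r = g'' @- s'"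
        using less.prems(2) by (cases g') auto
      from less.hyps[OF _ this(2) less.prems(2)] obtain g1 s1 where
        "r = g1 @- s1" "g'' = morph (SpinR b) g1" "s' = mu_inf (SpinR b) s1"
        by (auto simp: Cons g')
      then show ?thesis
        using False by (intro exI[of _ "c # g1"] exI[of _ s1]) (simp add: s e Cons g' morphR_def)
    qed
  qed
qed

text \<open>The blocks of L_b are b and bc with c other than b, so a cut inside a block is never
  followed by b.\<close>

lemma mu_inf_SpinL_split:
  assumes "mu_inf (SpinL b) s = g @- s'" and "shd s' = b"
  shows "\<exists>g1 s1. s = g1 @- s1 \<and> g = morph (SpinL b) g1 \<and> s' = mu_inf (SpinL b) s1"
  using assms
proof (induction "length g" arbitrary: g s rule: less_induct)
  case less
  show ?case
  proof (cases g)
    case Nil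
    then show ?thesis using less.prems by (intro exI[of _ "[]"] exI[of _ s]) simp
  next
    case (Cons c g')
    obtain e r where s: "s = e ## r" by (cases s)
    have c: "c = b" using less.prems(1) by (auto simp: s Cons morphL_def split: if_splits)
    show ?thesis
    proof (cases "e = b")
      case True
      then have "mu_inf (SpinL b) r = g' @- s'"
        using less.prems(1) by (simp add: s c Cons morphL_def)
      from less.hyps[OF _ this less.prems(2)] obtain g1 s1 where
        "r = g1 @- s1" "g' = morph (SpinL b) g1" "s' = mu_inf (SpinL b) s1"
        by (auto simp: Cons)
      then show ?thesis
        using True by (intro exI[of _ "e # g1"] exI[of _ s1]) (simp add: s c Cons morphL_def)
    next
      case False
      then have *: "e ## mu_inf (SpinL b) r = g' @- s'"
        using less.prems(1) by (simp add: s c Cons morphL_def)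
      then obtain g'' where g': "g' = e # g''" "mu_inf (SpinL b) r = g'' @- s'"
        using less.prems(2) False by (cases g') auto
      from less.hyps[OF _ this(2) less.prems(2)] obtain g1 s1 where
        "r = g1 @- s1" "g'' = morph (SpinL b) g1" "s' = mu_inf (SpinL b) s1"
        by (auto simp: Cons g')
      then show ?thesis
        using False by (intro exI[of _ "e # g1"] exI[of _ s1]) (simp add: s c Cons g' morphL_def)
    qed
  qed
qed

section \<open>The common prefix of all images as a quasiperiod\<close>

text \<open>Every image under L_b starts with b, so a guaranteed prefix p becomes L_b(p) b, while
  R_b adds no letter. If \<open>h\<close> has spin L only, this is the iterated palindromic closure
  of its letters.\<close>

fun lead :: "'a spinned list \<Rightarrow> 'a list" where
  "lead [] = []"
| "lead (SpinL b # h) = morph (SpinL b) (lead h) @ [b]"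
| "lead (SpinR b # h) = morph (SpinR b) (lead h)"

text \<open>Justin's formula for palindromic closures, extended to spinned words. It makes induction
  on the last letter of \<open>h\<close> possible.\<close>

lemma lead_append: "lead (h @ h') = morphs h (lead h') @ lead h"
  by (induction h rule: lead.induct) simp_all

lemma lead_prefix_of: "prefix_of (lead h) (foldr mu_inf h s)"
proof (induction h rule: lead.induct)
  case (2 b h)
  then obtain z where "foldr mu_inf h s = lead h @- z" by (auto simp: prefix_of_def)
  then show ?case by (auto simp: prefix_of_def mu_inf_SpinL_conv_SpinR[of b z])
next
  case (3 b h)
  then show ?case by (auto simp: prefix_of_def)
qed simp

lemma quasiperiod_lead:
  assumes "\<And>x. x \<in> sset s \<Longrightarrow> length (morphs h [x]) \<le> length (lead h)"
  shows "quasiperiod (lead h) (foldr mu_inf h s)"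
  unfolding quasiperiod_def
\<comment> \<open>Occurrences are taken at the block boundaries: the rest of the word is again an
  image under \<open>h\<close>, so it starts with \<open>lead h\<close>.\<close>
proof (intro exI[of _ "\<lambda>n. morphs h (stake n s)"] conjI allI)
  fix n
  have 1: "morphs h (stake (Suc n) s) = morphs h (stake n s) @ morphs h [s !! n]"
    by (simp add: stake_Suc del: stake.simps)
  show "length (morphs h (stake n s)) < length (morphs h (stake (Suc n) s))"
    by (simp add: 1 del: stake.simps)
  show "length (morphs h (stake (Suc n) s)) \<le> length (morphs h (stake n s) @ lead h)"
    using assms[of "s !! n"] by (simp add: 1 del: stake.simps)
  have "foldr mu_inf h s = morphs h (stake n s) @- foldr mu_inf h (sdrop n s)"
    by (metis foldr_mu_inf_shift stake_sdrop)
  then show "prefix_of (morphs h (stake n s) @ lead h) (foldr mu_inf h s)"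
    using lead_prefix_of[of h "sdrop n s"] by (auto simp: prefix_of_def)
qed simp

section \<open>Image lengths compared with the common prefix\<close>

lemma length_morphs_mu:
  "length (morphs h (mu x c)) =
     (if c = letter x then length (morphs h [c]) else length (morphs h [letter x]) + length (morphs h [c]))"
  using morphs_append[of h "[letter x]" "[c]"] morphs_append[of h "[c]" "[letter x]"]
  by (cases x) (auto simp: morphL_def morphR_def)

text \<open>Appending a letter y to \<open>h\<close> lengthens \<open>lead h\<close> by at most
  |h(y)|. At least one of \<open>a\<close>, \<open>b\<close> differs from y, so the sum on the right
  grows by at least |h(y)|.\<close>

lemma length_lead_less_two_letters:
  assumes "a \<noteq> b"
  shows "length (lead h) < length (morphs h [a]) + length (morphs h [b])"
proof (induction h rule: rev_induct)
  case (snoc x h)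
  then show ?case
    using assms by (cases x) (auto simp: lead_append length_morphs_mu simp del: mu.simps)
qed simp

definition covering_letter :: "'a spinned list \<Rightarrow> 'a \<Rightarrow> bool" where
  "covering_letter h x \<longleftrightarrow> (\<exists>h1 h2. h = h1 @ SpinL x # h2 \<and> (\<forall>b. SpinR b \<in> set h2 \<longrightarrow> b = x))"

lemma covering_letter_Nil [simp]: "\<not> covering_letter [] x"
  by (simp add: covering_letter_def)

lemma covering_letter_snoc:
  "covering_letter (h @ [y]) x \<longleftrightarrow> y = SpinL x \<or> covering_letter h x \<and> (\<forall>b. y = SpinR b \<longrightarrow> b = x)"
proof
  assume "covering_letter (h @ [y]) x"
  then obtain h1 h2 where "h @ [y] = h1 @ SpinL x # h2" "\<forall>b. SpinR b \<in> set h2 \<longrightarrow> b = x"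
    by (auto simp: covering_letter_def)
  then show "y = SpinL x \<or> covering_letter h x \<and> (\<forall>b. y = SpinR b \<longrightarrow> b = x)"
    by (cases h2 rule: rev_cases) (auto simp: covering_letter_def)
next
  assume "y = SpinL x \<or> covering_letter h x \<and> (\<forall>b. y = SpinR b \<longrightarrow> b = x)"
  then show "covering_letter (h @ [y]) x"
  proof
    assume "covering_letter h x \<and> (\<forall>b. y = SpinR b \<longrightarrow> b = x)"
    then obtain h1 h2 where "h = h1 @ SpinL x # h2"
      "\<forall>b. SpinR b \<in> set h2 \<longrightarrow> b = x" "\<forall>b. y = SpinR b \<longrightarrow> b = x"
      by (auto simp: covering_letter_def)
    then show ?thesis
      unfolding covering_letter_def by (intro exI[of _ h1] exI[of _ "h2 @ [y]"]) auto
  qed (force simp: covering_letter_def)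
qed

text \<open>Both sides change alike when a letter is appended. L-spinned x makes the inequality
  true; another L-spinned b adds |h(b)| to both lengths; R-spinned x changes nothing; another
  R-spinned b makes the left side |h(b)| + |h(x)|, which exceeds |lead h|.\<close>

lemma length_morphs_le_lead_iff:
  "length (morphs h [x]) \<le> length (lead h) \<longleftrightarrow> covering_letter h x"
proof (induction h rule: rev_induct)
  case (snoc y h)
  show ?case
  proof (cases y)
    case (SpinL b)
    then show ?thesis
      using snoc by (auto simp: covering_letter_snoc lead_append length_morphs_mu simp del: mu.simps)
  next
    case (SpinR b)
    then show ?thesis
      using snoc length_lead_less_two_letters[of b x h]
      by (auto simp: covering_letter_snoc lead_append length_morphs_mu simp del: mu.simps)
  qed
qed simp

section \<open>Carrying the covering condition through one morphism\<close>

text \<open>For \<open>h = []\<close> this says that each occurrence of \<open>u\<close> in \<open>t\<close> is followed by an overlapping or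
  adjacent one; in general it is the trace in \<open>t\<close> of the same condition for \<open>morphs h u @ lead h\<close>
  in the image of \<open>t\<close> under \<open>h\<close>.\<close>

definition covered :: "'a spinned list \<Rightarrow> 'a list \<Rightarrow> 'a stream \<Rightarrow> bool" where
  "covered h u t \<longleftrightarrow>
     (\<forall>p s. t = p @- s \<longrightarrow> prefix_of u s \<longrightarrow>
        (\<exists>g s'. g \<noteq> [] \<and> s = g @- s' \<and> prefix_of u s' \<and>
           length (morphs h g) \<le> length (morphs h u) + length (lead h)))"

lemma sset_split:
  assumes "x \<in> sset t"
  obtains p s where "t = p @- (x ## s)"
  using assms by (metis id_stake_snth_sdrop sset_range imageE)

text \<open>The empty word occurs just before \<open>x\<close>, and the next chosen occurrence lies
  beyond this \<open>x\<close>; hence the bound on the gap already bounds |h(x)|.\<close>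

lemma covered_Nil_imp_covering_letter:
  assumes "covered h [] t" and "x \<in> sset t"
  shows "covering_letter h x"
proof -
  obtain p s where t: "t = p @- (x ## s)"
    using assms(2) by (rule sset_split)
  obtain g s' where g: "g \<noteq> []" "x ## s = g @- s'" "length (morphs h g) \<le> length (lead h)"
    using assms(1)[unfolded covered_def, rule_format, OF t] by auto
  then obtain g' where "g = x # g'" by (cases g) auto
  then show ?thesis
    using g(3) morphs_Cons[of h x g'] by (simp flip: length_morphs_le_lead_iff)
qed

lemma quasiperiod_imp_covered:
  assumes "quasiperiod u t"
  shows "covered [] u t" and "prefix_of u t"
proof -
  obtain q where q: "q 0 = []" "\<And>n. length (q n) < length (q (Suc n))"
    "\<And>n. length (q (Suc n)) \<le> length (q n @ u)" "\<And>n. prefix_of (q n @ u) t"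
    using assms unfolding quasiperiod_def by blast
  show "prefix_of u t" using q(4)[of 0] q(1) by simp
  have ge: "n \<le> length (q n)" for n
    by (induction n) (use q(2) in \<open>auto intro: le_less_trans Suc_leI\<close>)
  show "covered [] u t"
    unfolding covered_def
  proof (intro allI impI)
    fix p s assume t: "t = p @- s" and u: "prefix_of u s"
    let ?P = "\<lambda>n. length p < length (q n)"
    \<comment> \<open>The first chosen occurrence starting beyond \<open>p\<close>. Its predecessor
      starts at or before the end of \<open>p\<close>, so this one starts at most |u| after
      \<open>p\<close>.\<close>
    define n where "n = (LEAST n. ?P n)"
    have n: "?P n" unfolding n_def by (rule LeastI[of ?P "Suc (length p)"]) (use ge[of "Suc (length p)"] in simp)
    then obtain m where m: "n = Suc m" using q(1) by (cases n) auto
    have "length (q m) \<le> length p"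
      using not_less_Least[of m ?P] unfolding n_def[symmetric] m by simp
    then have le: "length (q n) \<le> length p + length u" using q(3)[of m] m by simp
    obtain z where z: "t = q n @- u @- z" using q(4)[of n] by (auto simp: prefix_of_def)
    let ?k = "length (q n) - length p"
    have "sdrop ?k s = sdrop (length (q n)) t"
      using n by (simp add: t sdrop_shift)
    also have "\<dots> = u @- z" by (simp add: z sdrop_shift)
    finally have "prefix_of u (sdrop ?k s)" by (auto simp: prefix_of_def)
    moreover have "s = stake ?k s @- sdrop ?k s" by (simp add: stake_sdrop)
    ultimately show "\<exists>g s'. g \<noteq> [] \<and> s = g @- s' \<and> prefix_of u s' \<and>
           length (morphs [] g) \<le> length (morphs [] u) + length (lead [])"
      using n le by (intro exI[of _ "stake ?k s"] exI[of _ "sdrop ?k s"]) auto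
  qed
qed

lemma length_morphs_SpinL_SpinR:
  "length (morphs h (morph (SpinL b) u)) = length (morphs h (morph (SpinR b) u))"
  by (induction u) (simp_all add: length_morphs_mu del: mu.simps)

text \<open>As \<open>u\<close> begins some image, it splits into blocks b and cb, the last one
  possibly cut to c. Since c differs from b, even the cut block determines its source letter, so
  \<open>u1\<close> loses no information.\<close>

lemma prefix_of_mu_inf_SpinR_decode:
  assumes "prefix_of u (mu_inf (SpinR b) z)"
  shows "\<exists>u1. length u1 \<le> length u \<and> length (morphs h u) \<le> length (morphs h (morph (SpinR b) u1)) \<and>
           (\<forall>s. prefix_of u (mu_inf (SpinR b) s) \<longleftrightarrow> prefix_of u1 s)"
  using assms
proof (induction "length u" arbitrary: u z rule: less_induct)
  case less
  note unf = mu_inf_SpinR_unfold[of b]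
  show ?case
  proof (cases u)
    case Nil
    then show ?thesis by (intro exI[of _ "[]"]) simp
  next
    case (Cons c v)
    show ?thesis
    proof (cases "c = b")
      case True
      have "prefix_of v (mu_inf (SpinR b) (stl z))"
        using less.prems by (subst (asm) unf) (auto simp: Cons True prefix_of_Cons split: if_splits)
      from less.hyps[OF _ this] obtain v1 where v1: "length v1 \<le> length v"
        "length (morphs h v) \<le> length (morphs h (morph (SpinR b) v1))"
        "\<forall>s. prefix_of v (mu_inf (SpinR b) s) \<longleftrightarrow> prefix_of v1 s"
        by (auto simp: Cons)
      have "prefix_of u (mu_inf (SpinR b) s) \<longleftrightarrow> prefix_of (b # v1) s" for s
        using v1(3) by (subst unf) (auto simp: Cons True prefix_of_Cons)
      moreover have "length (morphs h u) \<le> length (morphs h (morph (SpinR b) (b # v1)))"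
        using v1(2) morphs_Cons[of h b v] morphs_Cons[of h b "morph (SpinR b) v1"]
        by (simp add: Cons True morphR_def)
      ultimately show ?thesis
        using v1(1) by (intro exI[of _ "b # v1"]) (auto simp: Cons)
    next
      case False
      show ?thesis
      proof (cases v)
        \<comment> \<open>Here \<open>u\<close> ends inside a block: the image of \<open>[c]\<close>
          is cb, longer than \<open>u\<close>, which is why the length claim is only an
          inequality.\<close>
        case Nil
        have "prefix_of u (mu_inf (SpinR b) s) \<longleftrightarrow> prefix_of [c] s" for s
          using False by (subst unf) (auto simp: Cons Nil prefix_of_Cons)
        then show ?thesis
          by (intro exI[of _ "[c]"]) (auto simp: Cons Nil length_morphs_mu simp del: mu.simps)
      next
        case (Cons e v')
        have e: "e = b" and "prefix_of v' (mu_inf (SpinR b) (stl z))"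
          using less.prems False
          by (subst (asm) (1) unf; auto simp: \<open>u = c # v\<close> Cons prefix_of_Cons split: if_splits)+
        from less.hyps[OF _ this(2)] obtain v1 where v1: "length v1 \<le> length v'"
          "length (morphs h v') \<le> length (morphs h (morph (SpinR b) v1))"
          "\<forall>s. prefix_of v' (mu_inf (SpinR b) s) \<longleftrightarrow> prefix_of v1 s"
          by (auto simp: Cons \<open>u = c # v\<close>)
        have u: "u = [c, b] @ v'" by (simp add: \<open>u = c # v\<close> Cons e)
        have "prefix_of u (mu_inf (SpinR b) s) \<longleftrightarrow> prefix_of (c # v1) s" for s
          using v1(3) False by (subst unf) (auto simp: u prefix_of_Cons)
        moreover have "length (morphs h u) \<le> length (morphs h (morph (SpinR b) (c # v1)))"
          using v1(2) False morphs_append[of h "[c, b]" v'] morphs_append[of h "[c, b]" "morph (SpinR b) v1"]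
          by (simp add: u morphR_def)
        ultimately show ?thesis
          using v1(1) by (intro exI[of _ "c # v1"]) (auto simp: u)
      qed
    qed
  qed
qed

text \<open>One step of the descent. For spin L, L_b(t) = b R_b(t) lets the leading b of
  \<open>u\<close> be removed before decoding, which makes \<open>u1\<close> shorter. For spin R,
  the condition on \<open>shd t\<close> makes \<open>u\<close> start with a letter other than b. In
  both cases the occurrences of \<open>u\<close> start at block boundaries.\<close>

lemma covered_desubstitute:
  assumes cov: "covered h u (mu_inf x t)" and pre: "prefix_of u (mu_inf x t)" and "u \<noteq> []"
    and R: "\<And>b. x = SpinR b \<Longrightarrow> shd t \<noteq> b"
  shows "\<exists>u1. prefix_of u1 t \<and> covered (h @ [x]) u1 t \<and> length u1 \<le> length u \<and>
           (is_SpinL x \<longrightarrow> length u1 < length u)"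
proof (cases x)
  case (SpinL b)
  obtain u0 where u: "u = b # u0" and u0: "prefix_of u0 (mu_inf (SpinR b) t)"
    using pre \<open>u \<noteq> []\<close> by (cases u) (auto simp: SpinL mu_inf_SpinL_conv_SpinR prefix_of_Cons)
  from prefix_of_mu_inf_SpinR_decode[OF u0, of h] obtain u1 where
    u1: "length u1 \<le> length u0" "length (morphs h u0) \<le> length (morphs h (morph (SpinR b) u1))"
    "\<And>s. prefix_of u0 (mu_inf (SpinR b) s) \<longleftrightarrow> prefix_of u1 s"
    by blast
  have u1': "prefix_of u (mu_inf x s) \<longleftrightarrow> prefix_of u1 s" for s
    by (simp add: SpinL u mu_inf_SpinL_conv_SpinR prefix_of_Cons u1(3))
  have "covered (h @ [x]) u1 t"
    unfolding covered_def
  proof (intro allI impI)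
    fix p s assume t: "t = p @- s" and "prefix_of u1 s"
    then obtain g s' where g: "g \<noteq> []" "mu_inf x s = g @- s'" "prefix_of u s'"
      "length (morphs h g) \<le> length (morphs h u) + length (lead h)"
      using cov u1' unfolding covered_def t mu_inf_shift by metis
    have "shd s' = b" using g(3) by (simp add: u prefix_of_Cons)
    from mu_inf_SpinL_split[OF g(2)[unfolded SpinL] this] obtain g1 s1 where
      1: "s = g1 @- s1" "g = morph x g1" "s' = mu_inf x s1"
      by (auto simp: SpinL)
    \<comment> \<open>The removed b is paid for by \<open>lead (h @ [x])\<close>, which is longer
      than \<open>lead h\<close> by |h(b)|.\<close>
    moreover have "length (morphs (h @ [x]) g1) \<le> length (morphs (h @ [x]) u1) + length (lead (h @ [x]))"
      using g(4) u1(2) morphs_Cons[of h b u0]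
      by (simp add: 1(2) u SpinL length_morphs_SpinL_SpinR lead_append)
    ultimately show "\<exists>g s'. g \<noteq> [] \<and> s = g @- s' \<and> prefix_of u1 s' \<and>
        length (morphs (h @ [x]) g) \<le> length (morphs (h @ [x]) u1) + length (lead (h @ [x]))"
      using g(1,3) u1' by auto
  qed
  then show ?thesis using u1(1) u1'[of t] pre by (auto simp: u)
next
  case (SpinR b)
  from prefix_of_mu_inf_SpinR_decode[OF pre[unfolded SpinR], of h] obtain u1 where
    u1: "length u1 \<le> length u" "length (morphs h u) \<le> length (morphs h (morph x u1))"
    "\<And>s. prefix_of u (mu_inf x s) \<longleftrightarrow> prefix_of u1 s"
    unfolding SpinR by blast
  obtain c u0 where u: "u = c # u0" using \<open>u \<noteq> []\<close> by (cases u) auto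
  have c: "c \<noteq> b"
    using pre R[OF SpinR] unfolding SpinR u prefix_of_Cons by (subst (asm) mu_inf_SpinR_unfold) auto
  have "covered (h @ [x]) u1 t"
    unfolding covered_def
  proof (intro allI impI)
    fix p s assume t: "t = p @- s" and "prefix_of u1 s"
    then obtain g s' where g: "g \<noteq> []" "mu_inf x s = g @- s'" "prefix_of u s'"
      "length (morphs h g) \<le> length (morphs h u) + length (lead h)"
      using cov u1(3) unfolding covered_def t mu_inf_shift by metis
    have "shd s' \<noteq> b" using g(3) c by (simp add: u prefix_of_Cons)
    from mu_inf_SpinR_split[OF g(2)[unfolded SpinR] this] obtain g1 s1 where
      1: "s = g1 @- s1" "g = morph x g1" "s' = mu_inf x s1"
      by (auto simp: SpinR)
    moreover have "length (morphs (h @ [x]) g1) \<le> length (morphs (h @ [x]) u1) + length (lead (h @ [x]))"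
      using g(4) u1(2) by (simp add: 1(2) SpinR lead_append)
    ultimately show "\<exists>g s'. g \<noteq> [] \<and> s = g @- s' \<and> prefix_of u1 s' \<and>
        length (morphs (h @ [x]) g) \<le> length (morphs (h @ [x]) u1) + length (lead (h @ [x]))"
      using g(1,3) u1(3) by auto
  qed
  then show ?thesis using u1(1) u1(3)[of t] pre by (auto simp: SpinR)
qed

section \<open>Letters of a directed word and of its directive word\<close>

text \<open>Under R_y a letter b other than y opens a block by. Spin L reduces to this by dropping
  the leading y, so the tail has the same form for both spins.\<close>

lemma mu_inf_split_at_letter:
  assumes "mu_inf x t = p @- (b ## s)" and "b \<noteq> letter x"
  shows "\<exists>p1 s1. t = p1 @- (b ## s1) \<and> s = letter x ## mu_inf (SpinR (letter x)) s1"
proof -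
  let ?y = "letter x"
  obtain p' where "mu_inf (SpinR ?y) t = p' @- (b ## s)"
  proof (cases x)
    case (SpinL y)
    then show ?thesis
      using assms that by (cases p) (auto simp: mu_inf_SpinL_conv_SpinR)
  qed (use assms that in auto)
  from mu_inf_SpinR_split[OF this] assms(2) obtain p1 s1 where
    1: "t = p1 @- s1" "b ## s = mu_inf (SpinR ?y) s1"
    by auto
  have "shd s1 = b" "s = ?y ## mu_inf (SpinR ?y) (stl s1)"
    using 1(2) assms(2) by (subst (asm) mu_inf_SpinR_unfold; auto split: if_splits)+
  with 1(1) show ?thesis
    by (intro exI[of _ p1] exI[of _ "stl s1"]) auto
qed

lemma set_stake_mu_inf_SpinR:
  "set (stake n (mu_inf (SpinR y) s)) \<subseteq> insert y (set (stake n s))"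
proof (induction n arbitrary: s rule: less_induct)
  case (less n)
  obtain c s' where s: "s = c ## s'" by (cases s)
  consider "n = 0" | "n = 1" | m where "n = Suc (Suc m)"
    by (metis One_nat_def not0_implies_Suc)
  then show ?case
  proof cases
    case 3
    have "set (stake m s') \<subseteq> set (stake (Suc m) s')"
      by (simp add: stake_Suc subset_insertI del: stake.simps)
    then show ?thesis
      using less.IH[of "Suc m" s'] less.IH[of m s'] 3
      by (auto simp: s morphR_def split: if_splits)
  qed (auto simp: s morphR_def)
qed

lemma letters_subset_directive_letters:
  assumes rec: "\<And>n. recurrent (ts n)" and ts: "\<And>n. ts n = mu_inf (d !! n) (ts (Suc n))"
  shows "sset (ts m) \<subseteq> letter ` sset (sdrop m d)"
proof
  fix b assume b: "b \<in> sset (ts m)"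
  show "b \<in> letter ` sset (sdrop m d)"
  proof (rule ccontr)
    assume notin: "b \<notin> letter ` sset (sdrop m d)"
    have ne: "b \<noteq> letter (d !! n)" if "m \<le> n" for n
    proof -
      have "d !! n = sdrop m d !! (n - m)" using that by (simp add: sdrop_snth)
      then show ?thesis using notin snth_sset by fastforce
    qed
    \<comment> \<open>Each desubstitution removes at least the letter \<open>letter (d !! n)\<close>
      from the gap after an occurrence of \<open>b\<close>, so no gap is finite: \<open>b\<close>
      would occur only once, against recurrence.\<close>
    have gap: "b \<notin> set (stake N s)" if "m \<le> n" "ts n = p @- (b ## s)" for N n p s
      using that
    proof (induction N arbitrary: n p s)
      case (Suc N)
      have "mu_inf (d !! n) (ts (Suc n)) = p @- (b ## s)" using Suc.prems(2) ts by metis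
      from mu_inf_split_at_letter[OF this ne[OF Suc.prems(1)]] obtain p1 s1 where
        1: "ts (Suc n) = p1 @- (b ## s1)" "s = letter (d !! n) ## mu_inf (SpinR (letter (d !! n))) s1"
        by auto
      have "b \<notin> set (stake N s1)" using Suc.IH[OF _ 1(1)] Suc.prems(1) by simp
      then show ?case
        using set_stake_mu_inf_SpinR[of N "letter (d !! n)" s1] ne[OF Suc.prems(1)] by (auto simp: 1(2))
    qed simp
    obtain p s where ps: "ts m = p @- (b ## s)" using b by (rule sset_split)
    then have "factor_of [b] (ts m)" by (auto simp: factor_of_def)
    then have "infinite {i. prefix_of [b] (sdrop i (ts m))}"
      using rec by (auto simp: recurrent_def)
    then obtain i where i: "prefix_of [b] (sdrop i (ts m))" "Suc (length p) \<le> i"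
      by (auto simp: finite_nat_set_iff_bounded not_less)
    have "b = ts m !! i" using i(1) by (simp add: prefix_of_Cons)
    also have "\<dots> = s !! (i - Suc (length p))"
      using i(2) by (simp add: ps Suc_diff_le) (metis Suc_diff_Suc Suc_le_eq snth_Stream)
    finally have "b \<in> set (stake (Suc (i - Suc (length p))) s)" by (simp add: stake_Suc del: stake.simps)
    then show False using gap[OF _ ps] by blast
  qed
qed

text \<open>Each block \<open>mu x c\<close> contains both \<open>c\<close> and
  \<open>letter x\<close>, so letters persist from \<open>ts (Suc n)\<close> to \<open>ts n\<close>,
  and \<open>letter (d !! n)\<close> occurs in \<open>ts n\<close>.\<close>

lemma directive_letters_subset_letters:
  assumes ts: "\<And>n. ts n = mu_inf (d !! n) (ts (Suc n))"
  shows "letter ` sset (sdrop m d) \<subseteq> sset (ts m)"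
proof -
  have step: "sset (ts (Suc n)) \<subseteq> sset (ts n)" for n
  proof
    fix c assume "c \<in> sset (ts (Suc n))"
    then obtain p s where "ts (Suc n) = p @- (c ## s)" by (rule sset_split)
    then have "ts n = morph (d !! n) p @- mu (d !! n) c @- mu_inf (d !! n) s"
      by (subst ts) simp
    then show "c \<in> sset (ts n)"
      by (cases "d !! n") (auto simp: morphL_def morphR_def)
  qed
  have mono: "sset (ts (m + k)) \<subseteq> sset (ts m)" for k
    by (induction k) (use step in auto)
  have "letter (d !! n) \<in> sset (ts n)" for n
  proof -
    obtain c s where "ts (Suc n) = c ## s" by (cases "ts (Suc n)")
    then have "ts n = mu (d !! n) c @- mu_inf (d !! n) s" by (subst ts) simp
    then show ?thesis by (cases "d !! n") (auto simp: morphL_def morphR_def)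
  qed
  then have "letter (sdrop m d !! k) \<in> sset (ts m)" for k
    using mono[of k] by (auto simp: sdrop_snth add.commute)
  then show ?thesis by (auto simp: sset_range)
qed

section \<open>First letters under normalization, and the descent\<close>

text \<open>R_b keeps the first letter and L_c makes it c, so the first L-spinned letter still to
  come decides.\<close>

lemma shd_directed:
  assumes ts: "\<And>n. ts n = mu_inf (d !! n) (ts (Suc n))"
    and "\<forall>k<j. \<not> is_SpinL (d !! (n + k))" and "d !! (n + j) = SpinL c"
  shows "shd (ts n) = c"
  using assms(2,3)
proof (induction j arbitrary: n)
  case 0
  then show ?case by (subst ts) (simp add: mu_inf_SpinL_conv_SpinR)
next
  case (Suc j)
  have "shd (ts (Suc n)) = c"
    using Suc.IH[of "Suc n"] Suc.prems by (metis Suc_mono add_Suc_shift)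
  moreover obtain b where "d !! n = SpinR b" using Suc.prems(1) by (cases "d !! n") force+
  ultimately show ?case
    by (subst ts) (simp, subst mu_inf_SpinR_unfold, simp)
qed

text \<open>If the first letter were \<open>b\<close>, the next L-spinned letter of \<open>d\<close>
  would be \<open>b\<close>, preceded by barred letters back to the barred \<open>b\<close> at
  \<open>n\<close>: a forbidden factor.\<close>

lemma normalized_shd_neq:
  assumes ts: "\<And>n. ts n = mu_inf (d !! n) (ts (Suc n))"
    and inf: "infinite {n. is_SpinL (d !! n)}"
    and norm: "\<And>a u. \<not> factor_of ([SpinR a] @ map SpinR u @ [SpinL a]) d"
    and n: "d !! n = SpinR b"
  shows "shd (ts (Suc n)) \<noteq> b"
proof
  assume b: "shd (ts (Suc n)) = b"
  let ?P = "\<lambda>j. is_SpinL (d !! (Suc n + j))"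
  obtain m where "Suc n \<le> m" "is_SpinL (d !! m)"
    using inf by (auto simp: finite_nat_set_iff_bounded not_less)
  then have ex: "?P (m - Suc n)" by simp
  define j where "j = (LEAST j. ?P j)"
  have j: "?P j" unfolding j_def by (rule LeastI[of ?P, OF ex])
  have less: "\<not> ?P k" if "k < j" for k using that not_less_Least[of k ?P] unfolding j_def by simp
  obtain c where c: "d !! (Suc n + j) = SpinL c" using j by (cases "d !! (Suc n + j)") auto
  have "c = b" using shd_directed[where ts = ts, OF ts _ c] less b by auto
  define r where "r = stake j (sdrop (Suc n) d)"
  have "x \<in> set r \<Longrightarrow> SpinR (letter x) = x" for x
    using less by (cases x) (auto simp: r_def in_set_conv_nth sdrop_snth add.commute, force)
  then have r: "map SpinR (map letter r) = r" by (simp add: map_idI)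
  have "d = stake n d @- (d !! n ## sdrop (Suc n) d)" by (rule id_stake_snth_sdrop)
  also have "sdrop (Suc n) d = r @- (sdrop (Suc n) d !! j ## sdrop (Suc j) (sdrop (Suc n) d))"
    unfolding r_def by (rule id_stake_snth_sdrop)
  also have "sdrop (Suc n) d !! j = SpinL b"
    using c \<open>c = b\<close> by (simp add: sdrop_snth add.commute del: sdrop.simps)
  finally have "factor_of ([SpinR b] @ map SpinR (map letter r) @ [SpinL b]) d"
    unfolding factor_of_def r n by (intro exI) simp
  with norm show False by blast
qed

lemma quasiperiodic_imp_covering_letters:
  assumes ts: "\<And>n. ts n = mu_inf (d !! n) (ts (Suc n))"
    and inf: "infinite {n. is_SpinL (d !! n)}"
    and norm: "\<And>a u. \<not> factor_of ([SpinR a] @ map SpinR u @ [SpinL a]) d"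
    and "quasiperiod u (ts 0)"
  shows "\<exists>n. \<forall>x\<in>sset (ts n). covering_letter (stake n d) x"
proof (rule ccontr)
  assume neg: "\<not> ?thesis"
  \<comment> \<open>The descent: the bound \<open>k\<close> survives every step and drops at each of
    the infinitely many L-spinned letters, while a covered empty word would make all letters of
    \<open>ts n\<close> covering.\<close>
  define P where "P n k \<longleftrightarrow>
    (\<exists>u. length u \<le> k \<and> prefix_of u (ts n) \<and> covered (stake n d) u (ts n))" for n k
  have not0: "u \<noteq> []" if "covered (stake n d) u (ts n)" for u n
    using that neg covered_Nil_imp_covering_letter by metis
  have step: "\<exists>u1. prefix_of u1 (ts (Suc n)) \<and> covered (stake (Suc n) d) u1 (ts (Suc n)) \<and>
      length u1 \<le> length u \<and> (is_SpinL (d !! n) \<longrightarrow> length u1 < length u)"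
    if "prefix_of u (ts n)" "covered (stake n d) u (ts n)" for n u
    unfolding stake_Suc
    by (rule covered_desubstitute)
      (use that not0 normalized_shd_neq[where ts = ts, OF ts inf norm] in \<open>auto simp flip: ts\<close>)
  have mono: "P (n + j) k" if "P n k" for n j k
  proof (induction j)
    case (Suc j)
    then show ?case using step[of _ "n + j"] unfolding P_def by (metis add_Suc_right le_trans)
  qed (use that in simp)
  have "\<not> P n k" for n k
  proof (induction k arbitrary: n)
    case 0
    then show ?case using not0 by (auto simp: P_def)
  next
    case (Suc k)
    show ?case
    proof
      assume "P n (Suc k)"
      obtain m where m: "n \<le> m" "is_SpinL (d !! m)"
        using inf by (auto simp: finite_nat_set_iff_bounded not_less)
      have "P m (Suc k)" using mono[OF \<open>P n (Suc k)\<close>, of "m - n"] m(1) by simp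
      then have "P (Suc m) k" using step[of _ m] m(2) unfolding P_def
        by (metis less_Suc_eq_le less_le_trans)
      with Suc.IH show False by blast
    qed
  qed
  moreover have "P 0 (length u)"
    using quasiperiod_imp_covered[OF assms(4)] by (auto simp: P_def)
  ultimately show False by blast
qed

section \<open>Covering letters and the factorization of the directive word\<close>

lemma covering_letter_last_occurrence:
  assumes "covering_letter h x"
  shows "\<exists>h1 h2. h = h1 @ SpinL x # h2 \<and> SpinL x \<notin> set h2 \<and> (\<forall>b. SpinR b \<in> set h2 \<longrightarrow> b = x)"
proof -
  obtain k1 k2 where k: "h = k1 @ SpinL x # k2" "\<forall>b. SpinR b \<in> set k2 \<longrightarrow> b = x"
    using assms by (auto simp: covering_letter_def)
  obtain l1 l2 where l: "SpinL x # k2 = l1 @ SpinL x # l2" "SpinL x \<notin> set l2"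
    using split_list_last[of "SpinL x" "SpinL x # k2"] by auto
  have "set l2 \<subseteq> insert (SpinL x) (set k2)"
    using arg_cong[OF l(1), of set] by auto
  then have "\<forall>b. SpinR b \<in> set l2 \<longrightarrow> b = x" using k(2) by auto
  moreover have "h = (k1 @ l1) @ SpinL x # l2" using k(1) l(1) by simp
  ultimately show ?thesis using l(2) by blast
qed

lemma spinned_block_form:
  assumes "\<forall>x\<in>set h. x = SpinR a \<or> (\<exists>b. b \<noteq> a \<and> x = SpinL b)"
  shows "\<exists>vs v. h = concat (map (\<lambda>u. map SpinL u @ [SpinR a]) vs) @ map SpinL v \<and>
           (\<forall>u\<in>set vs. a \<notin> set u) \<and> a \<notin> set v"
  using assms
proof (induction h)
  case (Cons x h)
  then obtain vs v where IH: "h = concat (map (\<lambda>u. map SpinL u @ [SpinR a]) vs) @ map SpinL v"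
    "\<forall>u\<in>set vs. a \<notin> set u" "a \<notin> set v"
    by auto
  consider "x = SpinR a" | b where "b \<noteq> a" "x = SpinL b" using Cons.prems by auto
  then show ?case
  proof cases
    case 1
    then show ?thesis using IH by (intro exI[of _ "[] # vs"] exI[of _ v]) auto
  next
    case 2
    show ?thesis
    proof (cases vs)
      case Nil
      then show ?thesis using IH 2 by (intro exI[of _ "[]"] exI[of _ "b # v"]) auto
    next
      case (Cons u us)
      then show ?thesis using IH 2 by (intro exI[of _ "(b # u) # us"] exI[of _ v]) auto
    qed
  qed
qed (intro exI[of _ "[]"], simp)

text \<open>If this \<open>z\<close> stood before the displayed \<open>y\<close>, then
  \<open>y\<close> would lie in \<open>k\<close>.\<close>

lemma in_set_suffix_if_notin:
  assumes "r @ y # s = q @ z # k" and "y \<notin> set k" and "y \<noteq> z"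
  shows "z \<in> set s"
  using assms
proof (induction r arbitrary: q)
  case Nil
  then show ?case by (cases q) auto
next
  case (Cons c r)
  then show ?case by (cases q) auto
qed

lemma covering_letters_imp_block_form:
  assumes "B \<noteq> {}" and cov: "\<And>x. x \<in> B \<Longrightarrow> covering_letter h x"
  shows "\<exists>a w vs v. h = w @ [SpinL a] @ concat (map (\<lambda>u. map SpinL u @ [SpinR a]) vs) @ map SpinL v \<and>
           (\<forall>u\<in>set vs. a \<notin> set u) \<and> a \<notin> set v \<and> B \<subseteq> set (a # v)"
proof -
  have "\<forall>x\<in>B. \<exists>h1 h2. h = h1 @ SpinL x # h2 \<and> SpinL x \<notin> set h2 \<and> (\<forall>b. SpinR b \<in> set h2 \<longrightarrow> b = x)"
    by (intro ballI covering_letter_last_occurrence cov)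
  then obtain f where
    "\<forall>x\<in>B. \<exists>h2. h = f x @ SpinL x # h2 \<and> SpinL x \<notin> set h2 \<and> (\<forall>b. SpinR b \<in> set h2 \<longrightarrow> b = x)"
    unfolding bchoice_iff[of B] ..
  then obtain g where
    "\<forall>x\<in>B. h = f x @ SpinL x # g x \<and> SpinL x \<notin> set (g x) \<and> (\<forall>b. SpinR b \<in> set (g x) \<longrightarrow> b = x)"
    unfolding bchoice_iff[of B] ..
  then have fg: "\<And>x. x \<in> B \<Longrightarrow> h = f x @ SpinL x # g x"
    "\<And>x. x \<in> B \<Longrightarrow> SpinL x \<notin> set (g x)" "\<And>x b. x \<in> B \<Longrightarrow> SpinR b \<in> set (g x) \<Longrightarrow> b = x"
    by simp_all
  obtain a where a: "a \<in> B" "\<And>x. x \<in> B \<Longrightarrow> length (f a) \<le> length (f x)"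
    using ex_has_least_nat[of "\<lambda>x. x \<in> B" _ "\<lambda>x. length (f x)"] assms(1) by blast
  have "\<forall>x\<in>set (g a). x = SpinR a \<or> (\<exists>b. b \<noteq> a \<and> x = SpinL b)"
    using fg(2,3)[OF a(1)] by (metis spinned.exhaust)
  from spinned_block_form[OF this] obtain vs v where
    vs: "g a = concat (map (\<lambda>u. map SpinL u @ [SpinR a]) vs) @ map SpinL v"
      "\<forall>u\<in>set vs. a \<notin> set u" "a \<notin> set v"
    by auto
  \<comment> \<open>By the choice of \<open>a\<close>, the last L-spinned \<open>x\<close> lies to
    the right of that of \<open>a\<close>. No barred \<open>a\<close> follows it, so it lies after
    the last barred \<open>a\<close>, hence in \<open>v\<close>.\<close>
  have "x \<in> set v" if x: "x \<in> B" "x \<noteq> a" for x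
  proof -
    have eq: "f a @ SpinL a # g a = f x @ SpinL x # g x" by (rule trans[OF fg(1)[OF a(1), symmetric] fg(1)[OF x(1)]])
    obtain q where q: "g a = q @ SpinL x # g x"
      using eq a(2)[OF x(1)] x(2)
      by (auto simp: append_eq_append_conv2 Cons_eq_append_conv append_eq_Cons_conv)
    show ?thesis
    proof (cases vs rule: rev_cases)
      case Nil
      then have "map SpinL v = q @ SpinL x # g x" using vs(1) q by simp
      then have "SpinL x \<in> set (map SpinL v)" by (metis in_set_conv_decomp)
      then show ?thesis by auto
    next
      case (snoc us u)
      then have "(concat (map (\<lambda>u. map SpinL u @ [SpinR a]) us) @ map SpinL u) @ SpinR a # map SpinL v =
          q @ SpinL x # g x"
        using vs(1) q by simp
      then obtain r where "r @ SpinR a # map SpinL v = q @ SpinL x # g x" ..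
      moreover have "SpinR a \<notin> set (g x)" using fg(3)[OF x(1)] x(2) by auto
      ultimately have "SpinL x \<in> set (map SpinL v)"
        by (rule in_set_suffix_if_notin) simp
      then show ?thesis by auto
    qed
  qed
  then show ?thesis
    using fg(1)[OF a(1)] vs by (intro exI[of _ a] exI[of _ "f a"] exI[of _ vs] exI[of _ v]) auto
qed

text \<open>An occurrence in \<open>v\<close> is followed by spin L only; after the displayed
  \<open>a\<close> the only barred letters are copies of \<open>a\<close>.\<close>

lemma block_form_imp_covering_letter:
  assumes "x \<in> set (a # v)"
  shows "covering_letter (w @ [SpinL a] @ concat (map (\<lambda>u. map SpinL u @ [SpinR a]) vs) @ map SpinL v) x"
proof (cases "x \<in> set v")
  case True
  then obtain v1 v2 where v: "v = v1 @ x # v2" by (auto dest: split_list)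
  show ?thesis
    unfolding covering_letter_def v
    by (rule exI[of _ "w @ [SpinL a] @ concat (map (\<lambda>u. map SpinL u @ [SpinR a]) vs) @ map SpinL v1"],
        rule exI[of _ "map SpinL v2"]) auto
next
  case False
  then have "x = a" using assms by simp
  then show ?thesis
    unfolding covering_letter_def
    by (intro exI[of _ w] exI[of _ "concat (map (\<lambda>u. map SpinL u @ [SpinR a]) vs) @ map SpinL v"]) auto
qed

theorem theorem4p29:
  fixes t :: "'a :: finite stream" and d :: "'a spinned stream"
  assumes "episturmian t"
    and "normalized_directive_word d t"
  shows "quasiperiodic t \<longleftrightarrow>
    (\<exists>(a :: 'a) (w :: 'a spinned list) (vs :: 'a list list) (v :: 'a list)
       (sy :: 'a spinned stream) (y :: 'a stream).
       d = w @- [SpinL a] @- concat (map (\<lambda>u. map SpinL u @ [SpinR a]) vs)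
             @- map SpinL v @- sy \<and>
       (\<forall>u\<in>set vs. a \<notin> set u) \<and> a \<notin> set v \<and>
       spinned_version sy y \<and>
       set (a # v) = sset ((a # v) @- y))"
    (is "_ \<longleftrightarrow> ?form")
proof -
  obtain ts where ts0: "ts 0 = t" and rec: "\<And>n. recurrent (ts n)"
    and ts: "\<And>n. ts n = mu_inf (d !! n) (ts (Suc n))"
    using assms(2) unfolding normalized_directive_word_def directs_def by blast
  have inf: "infinite {n. is_SpinL (d !! n)}"
    and norm: "\<And>a u. \<not> factor_of ([SpinR a] @ map SpinR u @ [SpinL a]) d"
    using assms(2) unfolding normalized_directive_word_def by blast+
  show ?thesis
  proof
    assume "quasiperiodic t"
    then obtain u where "quasiperiod u (ts 0)" unfolding quasiperiodic_def ts0 by blast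
    from quasiperiodic_imp_covering_letters[where ts = ts, OF ts inf norm this]
    obtain n where n: "\<And>x. x \<in> sset (ts n) \<Longrightarrow> covering_letter (stake n d) x" by blast
    \<comment> \<open>The alphabet of the infinite word y: the spinned tail \<open>sy\<close> will
      be \<open>sdrop n d\<close>.\<close>
    let ?B = "letter ` sset (sdrop n d)"
    have "?B \<noteq> {}" by (simp add: sset_range)
    moreover have "covering_letter (stake n d) x" if "x \<in> ?B" for x
      using directive_letters_subset_letters[where ts = ts, OF ts] that n by blast
    ultimately obtain a w vs v where
      h: "stake n d = w @ [SpinL a] @ concat (map (\<lambda>u. map SpinL u @ [SpinR a]) vs) @ map SpinL v"
      and free: "\<forall>u\<in>set vs. a \<notin> set u" "a \<notin> set v" and B: "?B \<subseteq> set (a # v)"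
      using covering_letters_imp_block_form[of ?B "stake n d"] by metis
    have "d = w @- [SpinL a] @- concat (map (\<lambda>u. map SpinL u @ [SpinR a]) vs)
             @- map SpinL v @- sdrop n d"
      using stake_sdrop[of n d] unfolding h by simp
    moreover have "set (a # v) = sset ((a # v) @- smap letter (sdrop n d))"
      using B by (auto simp: stream.set_map)
    ultimately show ?form
      using free unfolding spinned_version_def by blast
  next
    assume ?form
    then obtain a w vs v sy where
      d: "d = w @- [SpinL a] @- concat (map (\<lambda>u. map SpinL u @ [SpinR a]) vs) @- map SpinL v @- sy"
      and alph: "set (a # v) = sset ((a # v) @- smap letter sy)"
      unfolding spinned_version_def by blast
    define h where "h = w @ [SpinL a] @ concat (map (\<lambda>u. map SpinL u @ [SpinR a]) vs) @ map SpinL v"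
    have dh: "d = h @- sy" unfolding h_def by (subst d) simp
    have "foldr mu_inf (stake n d) (ts n) = t" for n
      by (induction n) (simp_all add: ts0 stake_Suc flip: ts del: stake.simps(2))
    from this[of "length h"] have t: "foldr mu_inf h (ts (length h)) = t"
      by (simp add: dh stake_shift)
    have "sset (ts (length h)) \<subseteq> letter ` sset sy"
      using letters_subset_directive_letters[where ts = ts, OF rec ts, of "length h"]
      by (simp add: dh sdrop_shift)
    \<comment> \<open>The alphabet condition puts all letters of y, hence those of
      \<open>ts (length h)\<close>, into \<open>set (a # v)\<close>.\<close>
    then have "covering_letter h x" if "x \<in> sset (ts (length h))" for x
      using that alph unfolding h_def by (intro block_form_imp_covering_letter) (auto simp: stream.set_map)
    then have "quasiperiod (lead h) t"
      using quasiperiod_lead[of "ts (length h)" h] unfolding length_morphs_le_lead_iff t by blast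
    then show "quasiperiodic t" unfolding quasiperiodic_def by blast
  qed
qed

end
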